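(* Let $G$ be a group with identity element $e$ and let $R=\oplus_{g\in G}R_g$ be a $G$-crossed product. The following three assertions are equivalent: (i) $R$ is $G$-controlled; (ii) $R_e$ is a simple ring and $C_R(R_e)=Z(R_e)$; (iii) $R_e$ is a simple ring and, for every $g\in G$ with $g\neq e$ and every invertible element $u_g\in R_g$, the automorphism $\sigma_g$ of $R_e$ defined by $\sigma_g(a)=u_g a u_g^{-1}$ for $a\in R_e$ is outer.
   Context: Rings are associative and unital. For subsets $X,Y$ of a ring, $XY$ denotes the set of all finite sums of elements $xy$ with $x\in X$, $y\in Y$. A ring $R$ is $G$-graded if there are additive subgroups $R_g$ ($g\in G$) of $R$ with $R=\oplus_{g\in G}R_g$ and $R_gR_h\subseteq R_{gh}$ for all $g,h\in G$. Then $R_e$ is a subring of $R$ with $1_R\in R_e$, and each $R_g$ is an $R_e$-bimodule by multiplication in $R$. For $H\subseteq G$ put $R_H=\oplus_{h\in H}R_h$, with $R_\varnothing=\{0\}$; it is an $R_e$-bimodule. A $G$-graded ring $R$ is a $G$-crossed product if for each $g\in G$ the component $R_g$ contains an element that is invertible in $R$. An automorphism of $R_e$ is inner if it has the form $a\mapsto vav^{-1}$ for some invertible $v\in R_e$, and outer if it is not inner. $C_R(R_e)$ is the set of elements of $R$ commuting with every element of $R_e$, and $Z(R_e)$ is the centre of $R_e$. The $G$-graded ring $R$ is called $G$-controlled if, for the given gradation: (1) the map $H\mapsto R_H=\oplus_{h\in H}R_h$ from the power set of $G$ to the set of all $R_e$-bimodules contained in $R$ (with scalar multiplication coming from the multiplication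 of $R$) is a bijection; and (2) for $S,T\subseteq G$, $R_S\cong R_T$ as $R_e$-bimodules if and only if $S=T$. *)

theory Defs
  imports "HOL-Algebra.Algebra"
begin

text \<open>Finite sums of products \<open>x y\<close> with \<open>x \<in> A\<close> and \<open>y \<in> B\<close>.\<close>

definition prod_set :: "('a, 'm) ring_scheme \<Rightarrow> 'a set \<Rightarrow> 'a set \<Rightarrow> 'a set" where
  "prod_set R A B =
     {finsum R (\<lambda>i. x i \<otimes>\<^bsub>R\<^esub> y i) {..<n} | (n::nat) x y. x \<in> {..<n} \<rightarrow> A \<and> y \<in> {..<n} \<rightarrow> B}"

text \<open>\<open>part R C H\<close> is the sum of the components \<open>C h\<close> with \<open>h \<in> H\<close>. It is direct for the components
  of a graded ring.\<close>

definition part :: "('a, 'm) ring_scheme \<Rightarrow> ('g \<Rightarrow> 'a set) \<Rightarrow> 'g set \<Rightarrow> 'a set" where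
  "part R C H =
     {finsum R x F | F x. finite F \<and> F \<subseteq> H \<and> x \<in> (\<Pi> h\<in>F. C h)}"

text \<open>The assumptions \<open>sum_components\<close> and \<open>sum_unique\<close> say that the ring is the internal direct
  sum of the components: every element is a finite sum of homogeneous elements, and the summands are
  unique. Values of \<open>C\<close> outside \<open>carrier G\<close> are irrelevant.\<close>

locale graded_ring = G: group G + R: ring R
  for G :: "('g, 'n) monoid_scheme" and R :: "('a, 'm) ring_scheme" and C :: "'g \<Rightarrow> 'a set" +
  assumes component_subgroup: "g \<in> carrier G \<Longrightarrow> additive_subgroup (C g) R"
    and sum_components: "part R C (carrier G) = carrier R"
    and sum_unique: "\<lbrakk>finite F; F \<subseteq> carrier G; x \<in> (\<Pi> g\<in>F. C g); y \<in> (\<Pi> g\<in>F. C g);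
          finsum R x F = finsum R y F; g \<in> F\<rbrakk> \<Longrightarrow> x g = y g"
    and component_mult: "\<lbrakk>g \<in> carrier G; h \<in> carrier G\<rbrakk> \<Longrightarrow>
          prod_set R (C g) (C h) \<subseteq> C (g \<otimes>\<^bsub>G\<^esub> h)"

locale crossed_product = graded_ring +
  assumes component_unit: "g \<in> carrier G \<Longrightarrow> \<exists>u. u \<in> C g \<and> u \<in> Units R"

definition base_ring ::
    "('g, 'n) monoid_scheme \<Rightarrow> ('a, 'm) ring_scheme \<Rightarrow> ('g \<Rightarrow> 'a set) \<Rightarrow> ('a, 'm) ring_scheme" where
  "base_ring G R C = R\<lparr>carrier := C \<one>\<^bsub>G\<^esub>\<rparr>"

definition sub_bimodule :: "('a, 'm) ring_scheme \<Rightarrow> 'a set \<Rightarrow> 'a set \<Rightarrow> bool" where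
  "sub_bimodule R A M \<longleftrightarrow> additive_subgroup M R \<and>
     (\<forall>a\<in>A. \<forall>m\<in>M. a \<otimes>\<^bsub>R\<^esub> m \<in> M \<and> m \<otimes>\<^bsub>R\<^esub> a \<in> M)"

definition bimodule_iso :: "('a, 'm) ring_scheme \<Rightarrow> 'a set \<Rightarrow> 'a set \<Rightarrow> 'a set \<Rightarrow> ('a \<Rightarrow> 'a) set" where
  "bimodule_iso R A M N = {f. bij_betw f M N \<and>
     (\<forall>m\<in>M. \<forall>m'\<in>M. f (m \<oplus>\<^bsub>R\<^esub> m') = f m \<oplus>\<^bsub>R\<^esub> f m') \<and>
     (\<forall>a\<in>A. \<forall>m\<in>M. f (a \<otimes>\<^bsub>R\<^esub> m) = a \<otimes>\<^bsub>R\<^esub> f m \<and> f (m \<otimes>\<^bsub>R\<^esub> a) = f m \<otimes>\<^bsub>R\<^esub> a)}"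

definition bimodule_isomorphic :: "('a, 'm) ring_scheme \<Rightarrow> 'a set \<Rightarrow> 'a set \<Rightarrow> 'a set \<Rightarrow> bool" where
  "bimodule_isomorphic R A M N \<longleftrightarrow> bimodule_iso R A M N \<noteq> {}"

definition controlled ::
    "('g, 'n) monoid_scheme \<Rightarrow> ('a, 'm) ring_scheme \<Rightarrow> ('g \<Rightarrow> 'a set) \<Rightarrow> bool" where
  "controlled G R C \<longleftrightarrow>
     bij_betw (part R C) (Pow (carrier G)) {M. sub_bimodule R (C \<one>\<^bsub>G\<^esub>) M} \<and>
     (\<forall>S T. S \<subseteq> carrier G \<longrightarrow> T \<subseteq> carrier G \<longrightarrow>
        (bimodule_isomorphic R (C \<one>\<^bsub>G\<^esub>) (part R C S) (part R C T) \<longleftrightarrow> S = T))"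

text \<open>The zero ring is not simple.\<close>

definition simple_ring :: "('a, 'm) ring_scheme \<Rightarrow> bool" where
  "simple_ring S \<longleftrightarrow> ring S \<and> carrier S \<noteq> {\<zero>\<^bsub>S\<^esub>} \<and>
     (\<forall>I. ideal I S \<longrightarrow> I = {\<zero>\<^bsub>S\<^esub>} \<or> I = carrier S)"

definition centralizer :: "('a, 'm) ring_scheme \<Rightarrow> 'a set \<Rightarrow> 'a set" where
  "centralizer R A = {r \<in> carrier R. \<forall>x\<in>A. r \<otimes>\<^bsub>R\<^esub> x = x \<otimes>\<^bsub>R\<^esub> r}"

definition centre :: "('a, 'm) ring_scheme \<Rightarrow> 'a set" where
  "centre S = centralizer S (carrier S)"

text \<open>Automorphisms are compared on the carrier only.\<close>

definition inner_aut :: "('a, 'm) ring_scheme \<Rightarrow> ('a \<Rightarrow> 'a) \<Rightarrow> bool" where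
  "inner_aut S \<sigma> \<longleftrightarrow> \<sigma> \<in> ring_iso S S \<and>
     (\<exists>v\<in>Units S. \<forall>a\<in>carrier S. \<sigma> a = v \<otimes>\<^bsub>S\<^esub> a \<otimes>\<^bsub>S\<^esub> inv\<^bsub>S\<^esub> v)"

definition outer_aut :: "('a, 'm) ring_scheme \<Rightarrow> ('a \<Rightarrow> 'a) \<Rightarrow> bool" where
  "outer_aut S \<sigma> \<longleftrightarrow> \<sigma> \<in> ring_iso S S \<and> \<not> inner_aut S \<sigma>"

end

theory Submission
  imports Defs
begin

text \<open>
  Write \<open>R\<^sub>g\<close> for the component \<open>C g\<close>. A unit \<open>u\<close> in \<open>R\<^sub>g\<close> gives \<open>R\<^sub>g = R\<^sub>e u\<close>, so as a bimodule \<open>R\<^sub>g\<close> is \<open>R\<^sub>e\<close> with one of its two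
  actions twisted by the automorphism \<open>a \<mapsto> u a u\<^sup>-\<^sup>1\<close>. Hence \<open>R\<^sub>g\<close> is a simple bimodule exactly when \<open>R\<^sub>e\<close> is
  a simple ring, and \<open>R\<^sub>g \<cong> R\<^sub>h\<close> exactly when the two twists differ by an inner automorphism. Being
  controlled amounts to the components being simple and pairwise non-isomorphic. The three
  assertions are linked in a cycle.

  If \<open>R\<close> is controlled, every ideal of \<open>R\<^sub>e\<close> is a sum of components inside \<open>R\<^sub>e\<close>, so \<open>R\<^sub>e\<close> is simple.
  If moreover \<open>u\<close> in \<open>R\<^sub>g\<close> acted by an inner automorphism, given by \<open>v\<close>, then \<open>v\<^sup>-\<^sup>1 u\<close> would be a unit of
  \<open>R\<^sub>g\<close> that commutes with \<open>R\<^sub>e\<close>, and multiplication by it would be an isomorphism \<open>R\<^sub>e \<cong> R\<^sub>g\<close>; so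
  \<open>g = e\<close> (lemmas \<open>controlled_imp_simple\<close> and \<open>controlled_imp_outer\<close>).

  If \<open>R\<^sub>e\<close> is simple and \<open>r\<close> centralizes it, so does each component of \<open>r\<close>. A nonzero element of
  \<open>R\<^sub>g\<close> that commutes with \<open>R\<^sub>e\<close> is a unit and acts by the identity, which is inner. When the
  automorphisms are outer, all components of \<open>r\<close> other than the one in \<open>R\<^sub>e\<close> therefore vanish
  (lemma \<open>outer_imp_centralizer\<close>).

  Finally let \<open>R\<^sub>e\<close> be simple with \<open>C\<^sub>R(R\<^sub>e) \<subseteq> R\<^sub>e\<close>. The key remark is that an element \<open>y\<close> with
  \<open>(u a u\<^sup>-\<^sup>1) y = y a\<close> for all \<open>a\<close>, where \<open>u\<close> is a unit in \<open>R\<^sub>g\<close>, lies in \<open>R\<^sub>g\<close>, because \<open>u\<^sup>-\<^sup>1 y\<close>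
  centralizes \<open>R\<^sub>e\<close> (lemma \<open>intertwiner_homogeneous\<close>). It is used twice. The image of \<open>u\<close> under a
  bimodule isomorphism satisfies this identity, so isomorphic sums of components have the same
  index set (lemma \<open>isomorphic_parts_subset\<close>). And in a sub-bimodule \<open>M\<close> with a nonzero
  \<open>g\<close>-component, an element of least support among those with \<open>g\<close>-component \<open>u\<close> satisfies it too,
  hence equals \<open>u\<close>; thus \<open>R\<^sub>g \<subseteq> M\<close> (lemma \<open>component_subset_sub_bimodule\<close>), and \<open>M\<close> is the sum of
  the components that it contains.
\<close>

section \<open>Homogeneous components\<close>

context graded_ring
begin

lemma component_closed: "g \<in> carrier G \<Longrightarrow> x \<in> C g \<Longrightarrow> x \<in> carrier R"
  using additive_subgroup.a_Hcarr[OF component_subgroup] by blast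

lemma component_zero: "g \<in> carrier G \<Longrightarrow> \<zero>\<^bsub>R\<^esub> \<in> C g"
  using additive_subgroup.zero_closed[OF component_subgroup] by blast

lemma component_add: "g \<in> carrier G \<Longrightarrow> x \<in> C g \<Longrightarrow> y \<in> C g \<Longrightarrow> x \<oplus>\<^bsub>R\<^esub> y \<in> C g"
  using additive_subgroup.a_closed[OF component_subgroup] by blast

lemma component_minus: "g \<in> carrier G \<Longrightarrow> x \<in> C g \<Longrightarrow> \<ominus>\<^bsub>R\<^esub> x \<in> C g"
  using additive_subgroup.a_inv_closed[OF component_subgroup] by blast

lemma component_prod:
  assumes g: "g \<in> carrier G" and h: "h \<in> carrier G" and x: "x \<in> C g" and y: "y \<in> C h"
  shows "x \<otimes>\<^bsub>R\<^esub> y \<in> C (g \<otimes>\<^bsub>G\<^esub> h)"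
proof -
  have c: "x \<in> carrier R" "y \<in> carrier R"
    using component_closed assms by blast+
  have "finsum R (\<lambda>i::nat. x \<otimes>\<^bsub>R\<^esub> y) {..<1} = x \<otimes>\<^bsub>R\<^esub> y"
    using c by (simp add: lessThan_Suc)
  then have "x \<otimes>\<^bsub>R\<^esub> y \<in> prod_set R (C g) (C h)"
    unfolding prod_set_def using x y
    by (intro CollectI exI[of _ "1::nat"] exI[of _ "\<lambda>_. x"] exI[of _ "\<lambda>_. y"]) auto
  then show ?thesis using component_mult[OF g h] by blast
qed

lemma components_Pi_closed:
  "F \<subseteq> carrier G \<Longrightarrow> x \<in> (\<Pi> g\<in>F. C g) \<Longrightarrow> x \<in> F \<rightarrow> carrier R"
proof (rule Pi_I)
  fix h assume "F \<subseteq> carrier G" "x \<in> (\<Pi> g\<in>F. C g)" "h \<in> F"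
  then show "x h \<in> carrier R" using component_closed[of h "x h"] by blast
qed

text \<open>Uniqueness for two different index sets: both families are extended by zero to the union, where the
  uniqueness axiom of the grading applies.\<close>

lemma finsum_components_unique:
  assumes F: "finite F" "F \<subseteq> carrier G" "x \<in> (\<Pi> g\<in>F. C g)"
    and F': "finite F'" "F' \<subseteq> carrier G" "y \<in> (\<Pi> g\<in>F'. C g)"
    and eq: "finsum R x F = finsum R y F'" and g: "g \<in> F" "g \<in> F'"
  shows "x g = y g"
proof -
  let ?x = "\<lambda>h. if h \<in> F then x h else \<zero>\<^bsub>R\<^esub>" and ?y = "\<lambda>h. if h \<in> F' then y h else \<zero>\<^bsub>R\<^esub>"
  have x: "?x \<in> (\<Pi> h\<in>F \<union> F'. C h)" and y: "?y \<in> (\<Pi> h\<in>F \<union> F'. C h)"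
    using F F' component_zero by (auto simp: Pi_iff subset_iff)
  have U: "finite (F \<union> F')" "F \<union> F' \<subseteq> carrier G" using F F' by auto
  have "finsum R ?x (F \<union> F') = finsum R x F"
    by (rule R.add.finprod_mono_neutral_cong_right)
      (use U components_Pi_closed[OF U(2) x] in auto)
  moreover have "finsum R ?y (F \<union> F') = finsum R y F'"
    by (rule R.add.finprod_mono_neutral_cong_right)
      (use U components_Pi_closed[OF U(2) y] in auto)
  ultimately have sums: "finsum R ?x (F \<union> F') = finsum R ?y (F \<union> F')"
    using eq by simp
  have "?x g = ?y g"
    by (rule sum_unique[OF U x y sums]) (use g in blast)
  then show ?thesis using g by simp
qed

text \<open>The description is not restricted to the support of \<open>r\<close>: any decomposition whose index set
  contains \<open>g\<close> may be used, and all of them have the same entry at \<open>g\<close>.\<close>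

definition component :: "'g \<Rightarrow> 'a \<Rightarrow> 'a" where
  "component g r = (THE c. \<exists>F x. finite F \<and> F \<subseteq> carrier G \<and> g \<in> F \<and> x \<in> (\<Pi> h\<in>F. C h) \<and>
     r = finsum R x F \<and> c = x g)"

lemma component_finsum:
  assumes F: "finite F" "F \<subseteq> carrier G" "x \<in> (\<Pi> h\<in>F. C h)" and g: "g \<in> carrier G"
  shows "component g (finsum R x F) = (if g \<in> F then x g else \<zero>\<^bsub>R\<^esub>)"
proof -
  let ?x = "\<lambda>h. if h \<in> F then x h else \<zero>\<^bsub>R\<^esub>"
  have x: "?x \<in> (\<Pi> h\<in>insert g F. C h)" using F component_zero g by auto
  have i: "finite (insert g F)" "insert g F \<subseteq> carrier G" using F g by auto
  have s: "finsum R x F = finsum R ?x (insert g F)"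
    by (rule R.add.finprod_mono_neutral_cong_left)
      (use i components_Pi_closed[OF i(2) x] in auto)
  have "component g (finsum R x F) = ?x g"
    unfolding component_def
  proof (rule the_equality)
    show "\<exists>F' y. finite F' \<and> F' \<subseteq> carrier G \<and> g \<in> F' \<and> y \<in> (\<Pi> h\<in>F'. C h) \<and>
       finsum R x F = finsum R y F' \<and> ?x g = y g"
      using i x s by (intro exI[of _ "insert g F"] exI[of _ ?x]) auto
  next
    fix c assume "\<exists>F' y. finite F' \<and> F' \<subseteq> carrier G \<and> g \<in> F' \<and> y \<in> (\<Pi> h\<in>F'. C h) \<and>
       finsum R x F = finsum R y F' \<and> c = y g"
    then obtain F' y where y: "finite F'" "F' \<subseteq> carrier G" "y \<in> (\<Pi> h\<in>F'. C h)"
      and gF: "g \<in> F'" and eq: "finsum R x F = finsum R y F'" and c: "c = y g"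
      by blast
    have "?x g = y g"
      by (rule finsum_components_unique[OF i x y]) (use s eq gF in auto)
    then show "c = ?x g" using c by simp
  qed
  then show ?thesis .
qed

definition support :: "'a \<Rightarrow> 'g set" where
  "support r = {g \<in> carrier G. component g r \<noteq> \<zero>\<^bsub>R\<^esub>}"

lemma obtain_decomposition:
  assumes "r \<in> carrier R"
  obtains F x where "finite F" "F \<subseteq> carrier G" "x \<in> (\<Pi> h\<in>F. C h)" "r = finsum R x F"
proof -
  have "r \<in> part R C (carrier G)" using assms sum_components by simp
  then show ?thesis using that unfolding part_def by auto
qed

lemma component_in: "r \<in> carrier R \<Longrightarrow> g \<in> carrier G \<Longrightarrow> component g r \<in> C g"
  by (erule obtain_decomposition) (auto simp: component_finsum component_zero)

lemma component_carrier: "r \<in> carrier R \<Longrightarrow> g \<in> carrier G \<Longrightarrow> component g r \<in> carrier R"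
  using component_in component_closed by blast

lemma finite_support: "r \<in> carrier R \<Longrightarrow> finite (support r)"
proof (erule obtain_decomposition)
  fix F x assume F: "finite F" "F \<subseteq> carrier G" "x \<in> (\<Pi> h\<in>F. C h)" "r = finsum R x F"
  have "support r \<subseteq> F"
    unfolding support_def using F by (auto simp: component_finsum split: if_splits)
  then show ?thesis using F finite_subset by blast
qed

lemma finsum_component:
  assumes r: "r \<in> carrier R" and F: "finite F" "support r \<subseteq> F" "F \<subseteq> carrier G"
  shows "finsum R (\<lambda>g. component g r) F = r"
proof -
  obtain F' x where x: "finite F'" "F' \<subseteq> carrier G" "x \<in> (\<Pi> h\<in>F'. C h)" "r = finsum R x F'"
    using obtain_decomposition[OF r] by blast
  have xg: "component g r = (if g \<in> F' then x g else \<zero>\<^bsub>R\<^esub>)" if "g \<in> carrier G" for g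
    using component_finsum[OF x(1-3) that] x(4) by simp
  have "finsum R (\<lambda>g. component g r) F = finsum R x F'"
  proof (rule R.add.finprod_mono_neutral_cong)
    show "finite F'" "finite F" by fact+
    show "x i = \<zero>\<^bsub>R\<^esub>" if "i \<in> F' - F" for i
    proof -
      have "i \<in> carrier G" "i \<notin> support r" using that F x(2) by blast+
      then show ?thesis using xg[of i] that unfolding support_def by auto
    qed
    show "component i r = \<zero>\<^bsub>R\<^esub>" if "i \<in> F - F'" for i
      using that xg[of i] F by auto
    show "component i r = x i" if "i \<in> F \<inter> F'" for i
      using that xg[of i] F by auto
    show "(\<lambda>g. component g r) \<in> F \<rightarrow> carrier R"
      using component_carrier r F by auto
    show "x \<in> F' \<rightarrow> carrier R" using components_Pi_closed x by blast
  qed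
  then show ?thesis using x by simp
qed

lemma component_homogeneous:
  assumes "h \<in> carrier G" "c \<in> C h" "g \<in> carrier G"
  shows "component g c = (if g = h then c else \<zero>\<^bsub>R\<^esub>)"
proof -
  have "finsum R (\<lambda>_. c) {h} = c"
    using assms component_closed by simp
  then show ?thesis
    using component_finsum[of "{h}" "\<lambda>_. c" g] assms by auto
qed

lemma component_eqI:
  assumes "r \<in> carrier R" "s \<in> carrier R"
    and "\<And>g. g \<in> carrier G \<Longrightarrow> component g r = component g s"
  shows "r = s"
proof -
  have sup: "support r = support s" using assms(3) unfolding support_def by auto
  have s: "support s \<subseteq> carrier G" unfolding support_def by auto
  have "r = finsum R (\<lambda>g. component g r) (support s)"
    using finsum_component[OF assms(1) finite_support[OF assms(2)]] sup s by simp
  also have "... = finsum R (\<lambda>g. component g s) (support s)"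
    by (rule R.finsum_cong') (use assms s component_carrier in auto)
  also have "... = s"
    using finsum_component[OF assms(2) finite_support[OF assms(2)]] s by simp
  finally show ?thesis .
qed

lemma component_of_zero: "g \<in> carrier G \<Longrightarrow> component g \<zero>\<^bsub>R\<^esub> = \<zero>\<^bsub>R\<^esub>"
  using component_homogeneous[of g "\<zero>\<^bsub>R\<^esub>" g] component_zero by simp

lemma component_of_sum:
  assumes r: "r \<in> carrier R" and s: "s \<in> carrier R" and g: "g \<in> carrier G"
  shows "component g (r \<oplus>\<^bsub>R\<^esub> s) = component g r \<oplus>\<^bsub>R\<^esub> component g s"
proof -
  let ?F = "support r \<union> support s"
  have F: "finite ?F" "?F \<subseteq> carrier G"
    using finite_support r s unfolding support_def by auto
  have pr: "(\<lambda>g. component g r) \<in> ?F \<rightarrow> carrier R" and ps: "(\<lambda>g. component g s) \<in> ?F \<rightarrow> carrier R"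
    using component_carrier r s F by auto
  have Pi: "(\<lambda>g. component g r \<oplus>\<^bsub>R\<^esub> component g s) \<in> (\<Pi> g\<in>?F. C g)"
    using F component_add component_in r s by (auto simp: subset_iff)
  have "finsum R (\<lambda>g. component g r \<oplus>\<^bsub>R\<^esub> component g s) ?F = r \<oplus>\<^bsub>R\<^esub> s"
    using R.finsum_addf[OF pr ps] finsum_component[OF r F(1) _ F(2)]
      finsum_component[OF s F(1) _ F(2)] by simp
  then have "component g (r \<oplus>\<^bsub>R\<^esub> s) = (if g \<in> ?F then component g r \<oplus>\<^bsub>R\<^esub> component g s else \<zero>\<^bsub>R\<^esub>)"
    using component_finsum[OF F Pi g] by simp
  then show ?thesis using g unfolding support_def by auto
qed

lemma component_of_diff:
  assumes r: "r \<in> carrier R" and s: "s \<in> carrier R" and g: "g \<in> carrier G"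
  shows "component g (r \<ominus>\<^bsub>R\<^esub> s) = component g r \<ominus>\<^bsub>R\<^esub> component g s"
proof -
  have c: "component g (r \<ominus>\<^bsub>R\<^esub> s) \<in> carrier R" "component g s \<in> carrier R"
    using component_carrier r s g by auto
  have "component g r = component g ((r \<ominus>\<^bsub>R\<^esub> s) \<oplus>\<^bsub>R\<^esub> s)"
    using r s by (simp add: a_minus_def R.a_assoc R.l_neg)
  also have "... = component g (r \<ominus>\<^bsub>R\<^esub> s) \<oplus>\<^bsub>R\<^esub> component g s"
    using component_of_sum[of "r \<ominus>\<^bsub>R\<^esub> s" s] r s g by simp
  finally show ?thesis using c by (simp add: a_minus_def R.a_assoc R.r_neg)
qed

text \<open>Left multiplication by an element of \<open>R\<^sub>h\<close> translates degrees by \<open>h\<close>. The index \<open>g\<close> is added to the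
  support so that the translated index set contains the degree under consideration.\<close>

lemma component_of_left_mult:
  assumes a: "a \<in> C h" and h: "h \<in> carrier G" and r: "r \<in> carrier R" and g: "g \<in> carrier G"
  shows "component (h \<otimes>\<^bsub>G\<^esub> g) (a \<otimes>\<^bsub>R\<^esub> r) = a \<otimes>\<^bsub>R\<^esub> component g r"
proof -
  let ?F = "insert g (support r)"
  let ?y = "\<lambda>j. a \<otimes>\<^bsub>R\<^esub> component (inv\<^bsub>G\<^esub> h \<otimes>\<^bsub>G\<^esub> j) r"
  have F: "finite ?F" "?F \<subseteq> carrier G"
    using finite_support r g unfolding support_def by auto
  have ac: "a \<in> carrier R" using component_closed a h by blast
  have inv: "inv\<^bsub>G\<^esub> h \<otimes>\<^bsub>G\<^esub> (h \<otimes>\<^bsub>G\<^esub> k) = k" if "k \<in> carrier G" for k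
    using that h by (simp add: G.m_assoc[symmetric])
  have y: "?y (h \<otimes>\<^bsub>G\<^esub> k) = a \<otimes>\<^bsub>R\<^esub> component k r" if "k \<in> ?F" for k
    using that F inv by auto
  have y_in: "?y \<in> (\<Pi> j\<in>(\<lambda>k. h \<otimes>\<^bsub>G\<^esub> k) ` ?F. C j)"
  proof
    fix j assume "j \<in> (\<lambda>k. h \<otimes>\<^bsub>G\<^esub> k) ` ?F"
    then obtain k where k: "k \<in> ?F" "j = h \<otimes>\<^bsub>G\<^esub> k" by blast
    then show "?y j \<in> C j"
      using y component_prod[OF h _ a] component_in[OF r] F by auto
  qed
  have Fh: "finite ((\<lambda>k. h \<otimes>\<^bsub>G\<^esub> k) ` ?F)" "(\<lambda>k. h \<otimes>\<^bsub>G\<^esub> k) ` ?F \<subseteq> carrier G"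
    using F h by auto
  have inj: "inj_on (\<lambda>k. h \<otimes>\<^bsub>G\<^esub> k) ?F"
    by (rule inj_onI) (use F h G.l_cancel in blast)
  have pr: "(\<lambda>k. component k r) \<in> ?F \<rightarrow> carrier R"
    using component_carrier r F by auto
  have "a \<otimes>\<^bsub>R\<^esub> r = a \<otimes>\<^bsub>R\<^esub> finsum R (\<lambda>k. component k r) ?F"
    using finsum_component[OF r F(1) subset_insertI F(2)] by simp
  also have "... = finsum R (\<lambda>k. a \<otimes>\<^bsub>R\<^esub> component k r) ?F"
    by (rule R.finsum_rdistr[OF F(1) ac pr])
  also have "... = finsum R (\<lambda>k. ?y (h \<otimes>\<^bsub>G\<^esub> k)) ?F"
    by (rule R.finsum_cong') (use y ac components_Pi_closed[OF Fh(2) y_in] in auto)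
  also have "... = finsum R ?y ((\<lambda>k. h \<otimes>\<^bsub>G\<^esub> k) ` ?F)"
    by (rule R.finsum_reindex[symmetric, OF components_Pi_closed[OF Fh(2) y_in] inj])
  finally show ?thesis
    using component_finsum[OF Fh y_in, of "h \<otimes>\<^bsub>G\<^esub> g"] h g y[of g] by auto
qed

section \<open>The base ring\<close>

abbreviation base :: "'a set" where "base \<equiv> C \<one>\<^bsub>G\<^esub>"

text \<open>The \<open>e\<close>-component of \<open>1\<close> is a right identity on each component: compare the parts of degree \<open>g\<close> in
  \<open>c = c 1\<close>. By additivity it is a right identity on \<open>R\<close>, hence it is \<open>1\<close>.\<close>

lemma one_in_base: "\<one>\<^bsub>R\<^esub> \<in> base"
proof -
  let ?e = "component \<one>\<^bsub>G\<^esub> \<one>\<^bsub>R\<^esub>"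
  have e: "?e \<in> carrier R" using component_carrier by simp
  have hom: "c \<otimes>\<^bsub>R\<^esub> ?e = c" if "g \<in> carrier G" "c \<in> C g" for g c
    using component_of_left_mult[OF that(2,1), of "\<one>\<^bsub>R\<^esub>" "\<one>\<^bsub>G\<^esub>"] component_homogeneous[OF that that(1)]
      component_closed[OF that] that by simp
  have F: "finite (support \<one>\<^bsub>R\<^esub>)" "support \<one>\<^bsub>R\<^esub> \<subseteq> carrier G"
    using finite_support unfolding support_def by auto
  have p: "(\<lambda>g. component g \<one>\<^bsub>R\<^esub>) \<in> support \<one>\<^bsub>R\<^esub> \<rightarrow> carrier R"
    using component_carrier F by auto
  have s: "finsum R (\<lambda>g. component g \<one>\<^bsub>R\<^esub>) (support \<one>\<^bsub>R\<^esub>) = \<one>\<^bsub>R\<^esub>"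
    using finsum_component[OF R.one_closed F(1) _ F(2)] by simp
  have "?e = \<one>\<^bsub>R\<^esub> \<otimes>\<^bsub>R\<^esub> ?e" using e by simp
  also have "... = finsum R (\<lambda>g. component g \<one>\<^bsub>R\<^esub> \<otimes>\<^bsub>R\<^esub> ?e) (support \<one>\<^bsub>R\<^esub>)"
    using R.finsum_ldistr[OF F(1) e p] s by simp
  also have "... = finsum R (\<lambda>g. component g \<one>\<^bsub>R\<^esub>) (support \<one>\<^bsub>R\<^esub>)"
    by (rule R.finsum_cong') (use hom component_in F p in auto)
  finally have "?e = \<one>\<^bsub>R\<^esub>" using s by simp
  then show ?thesis using component_in[of "\<one>\<^bsub>R\<^esub>" "\<one>\<^bsub>G\<^esub>"] by simp
qed

lemma base_closed: "a \<in> base \<Longrightarrow> a \<in> carrier R"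
  using component_closed by blast

lemma base_mult: "a \<in> base \<Longrightarrow> b \<in> base \<Longrightarrow> a \<otimes>\<^bsub>R\<^esub> b \<in> base"
  using component_prod[of "\<one>\<^bsub>G\<^esub>" "\<one>\<^bsub>G\<^esub>"] by simp

lemma component_of_base_left:
  assumes "a \<in> base" "r \<in> carrier R" "g \<in> carrier G"
  shows "component g (a \<otimes>\<^bsub>R\<^esub> r) = a \<otimes>\<^bsub>R\<^esub> component g r"
  using component_of_left_mult[OF assms(1) _ assms(2,3)] assms(3) by simp

lemma component_of_base_right:
  assumes a: "a \<in> base" and r: "r \<in> carrier R" and g: "g \<in> carrier G"
  shows "component g (r \<otimes>\<^bsub>R\<^esub> a) = component g r \<otimes>\<^bsub>R\<^esub> a"
proof -
  let ?F = "support r"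
  have F: "finite ?F" "?F \<subseteq> carrier G"
    using finite_support r unfolding support_def by auto
  have ac: "a \<in> carrier R" using base_closed a .
  have pr: "(\<lambda>k. component k r) \<in> ?F \<rightarrow> carrier R"
    using component_carrier r F by auto
  have y: "(\<lambda>k. component k r \<otimes>\<^bsub>R\<^esub> a) \<in> (\<Pi> k\<in>?F. C k)"
  proof
    fix k assume "k \<in> ?F"
    then have k: "k \<in> carrier G" using F by blast
    show "component k r \<otimes>\<^bsub>R\<^esub> a \<in> C k"
      using component_prod[OF k G.one_closed component_in[OF r k] a] k by simp
  qed
  have "r \<otimes>\<^bsub>R\<^esub> a = finsum R (\<lambda>k. component k r) ?F \<otimes>\<^bsub>R\<^esub> a"
    using finsum_component[OF r F(1) _ F(2)] by simp
  also have "... = finsum R (\<lambda>k. component k r \<otimes>\<^bsub>R\<^esub> a) ?F"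
    by (rule R.finsum_ldistr[OF F(1) ac pr])
  finally have "component g (r \<otimes>\<^bsub>R\<^esub> a) = (if g \<in> ?F then component g r \<otimes>\<^bsub>R\<^esub> a else \<zero>\<^bsub>R\<^esub>)"
    using component_finsum[OF F y g] by simp
  then show ?thesis using g ac unfolding support_def by auto
qed

lemma base_module_component:
  assumes "a \<in> base" "g \<in> carrier G" "c \<in> C g"
  shows "a \<otimes>\<^bsub>R\<^esub> c \<in> C g" "c \<otimes>\<^bsub>R\<^esub> a \<in> C g"
  using component_prod[of "\<one>\<^bsub>G\<^esub>" g a c] component_prod[of g "\<one>\<^bsub>G\<^esub>" c a] assms by auto

text \<open>In \<open>u u\<^sup>-\<^sup>1 = 1\<close> only the component of \<open>u\<^sup>-\<^sup>1\<close> of degree \<open>g\<^sup>-\<^sup>1\<close> contributes to degree \<open>e\<close>, so this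
  component is already a right inverse of \<open>u\<close>.\<close>

lemma inv_homogeneous:
  assumes g: "g \<in> carrier G" and u: "u \<in> C g" "u \<in> Units R"
  shows "inv\<^bsub>R\<^esub> u \<in> C (inv\<^bsub>G\<^esub> g)"
proof -
  let ?v = "component (inv\<^bsub>G\<^esub> g) (inv\<^bsub>R\<^esub> u)"
  have c: "u \<in> carrier R" "inv\<^bsub>R\<^esub> u \<in> carrier R" "?v \<in> carrier R"
    using u g component_carrier by auto
  have "component \<one>\<^bsub>G\<^esub> (u \<otimes>\<^bsub>R\<^esub> inv\<^bsub>R\<^esub> u) = u \<otimes>\<^bsub>R\<^esub> ?v"
    using component_of_left_mult[OF u(1) g c(2), of "inv\<^bsub>G\<^esub> g"] g by simp
  then have "u \<otimes>\<^bsub>R\<^esub> ?v = \<one>\<^bsub>R\<^esub>"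
    using component_homogeneous[OF _ one_in_base, of "\<one>\<^bsub>G\<^esub>"] u by simp
  then have "inv\<^bsub>R\<^esub> u = ?v"
    using R.inv_unique[of "inv\<^bsub>R\<^esub> u" u ?v] u c by simp
  then show ?thesis using component_in[OF c(2), of "inv\<^bsub>G\<^esub> g"] g by simp
qed

lemma conjugate_in_base:
  assumes g: "g \<in> carrier G" and u: "u \<in> C g" "u \<in> Units R" and a: "a \<in> base"
  shows "u \<otimes>\<^bsub>R\<^esub> a \<otimes>\<^bsub>R\<^esub> inv\<^bsub>R\<^esub> u \<in> base" "inv\<^bsub>R\<^esub> u \<otimes>\<^bsub>R\<^esub> a \<otimes>\<^bsub>R\<^esub> u \<in> base"
  using component_prod[of g "inv\<^bsub>G\<^esub> g" "u \<otimes>\<^bsub>R\<^esub> a" "inv\<^bsub>R\<^esub> u"] component_prod[of "inv\<^bsub>G\<^esub> g" g "inv\<^bsub>R\<^esub> u \<otimes>\<^bsub>R\<^esub> a" u]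
    base_module_component[OF a] inv_homogeneous[OF g u] g u by auto

lemma ring_base: "ring (base_ring G R C)"
  unfolding base_ring_def
  by (rule R.subring_is_ring, rule R.subringI)
    (use one_in_base base_closed base_mult component_minus component_add in auto)

lemma base_ring_simps [simp]:
  "carrier (base_ring G R C) = base"
  "monoid.mult (base_ring G R C) = monoid.mult R"
  "ring.add (base_ring G R C) = ring.add R"
  "monoid.one (base_ring G R C) = \<one>\<^bsub>R\<^esub>"
  "ring.zero (base_ring G R C) = \<zero>\<^bsub>R\<^esub>"
  by (simp_all add: base_ring_def)

lemma Units_base: "Units (base_ring G R C) = base \<inter> Units R"
proof
  show "Units (base_ring G R C) \<subseteq> base \<inter> Units R"
    unfolding Units_def using base_closed by auto
  show "base \<inter> Units R \<subseteq> Units (base_ring G R C)"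
  proof
    fix v assume v: "v \<in> base \<inter> Units R"
    then have "inv\<^bsub>R\<^esub> v \<in> base" using inv_homogeneous[of "\<one>\<^bsub>G\<^esub>" v] by simp
    moreover have "inv\<^bsub>R\<^esub> v \<otimes>\<^bsub>R\<^esub> v = \<one>\<^bsub>R\<^esub>" "v \<otimes>\<^bsub>R\<^esub> inv\<^bsub>R\<^esub> v = \<one>\<^bsub>R\<^esub>" using v by auto
    ultimately show "v \<in> Units (base_ring G R C)"
      using v unfolding Units_def by auto
  qed
qed

lemma inv_base:
  assumes "v \<in> Units (base_ring G R C)"
  shows "inv\<^bsub>base_ring G R C\<^esub> v = inv\<^bsub>R\<^esub> v"
proof -
  interpret B: ring "base_ring G R C" by (rule ring_base)
  have v: "v \<in> base" "v \<in> Units R" using assms Units_base by auto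
  have "inv\<^bsub>base_ring G R C\<^esub> v \<otimes>\<^bsub>R\<^esub> v = \<one>\<^bsub>R\<^esub>" "inv\<^bsub>base_ring G R C\<^esub> v \<in> base"
    using B.Units_l_inv[OF assms] B.Units_inv_closed[OF assms] by simp_all
  then show ?thesis
    using R.inv_unique[of "inv\<^bsub>base_ring G R C\<^esub> v" v "inv\<^bsub>R\<^esub> v"] v base_closed by simp
qed

text \<open>Closure under negation comes for free from multiplication by \<open>-1\<close>.\<close>

lemma sub_bimoduleI:
  assumes M: "M \<subseteq> carrier R" "\<zero>\<^bsub>R\<^esub> \<in> M"
    and add: "\<And>x y. x \<in> M \<Longrightarrow> y \<in> M \<Longrightarrow> x \<oplus>\<^bsub>R\<^esub> y \<in> M"
    and mult: "\<And>a x. a \<in> base \<Longrightarrow> x \<in> M \<Longrightarrow> a \<otimes>\<^bsub>R\<^esub> x \<in> M \<and> x \<otimes>\<^bsub>R\<^esub> a \<in> M"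
  shows "sub_bimodule R base M"
proof -
  have minus: "\<ominus>\<^bsub>R\<^esub> x \<in> M" if "x \<in> M" for x
    using mult[of "\<ominus>\<^bsub>R\<^esub> \<one>\<^bsub>R\<^esub>" x] that M component_minus[OF _ one_in_base]
      R.l_minus[OF R.one_closed, of x] by auto
  have "additive_subgroup M R"
    by (rule additive_subgroupI, rule R.add.subgroupI) (use M add minus in \<open>auto simp: a_inv_def\<close>)
  then show ?thesis using mult unfolding sub_bimodule_def by blast
qed

lemma sub_bimoduleD:
  assumes "sub_bimodule R base M"
  shows "M \<subseteq> carrier R" "\<zero>\<^bsub>R\<^esub> \<in> M"
    and "\<And>x y. x \<in> M \<Longrightarrow> y \<in> M \<Longrightarrow> x \<oplus>\<^bsub>R\<^esub> y \<in> M"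
    and "\<And>x y. x \<in> M \<Longrightarrow> y \<in> M \<Longrightarrow> x \<ominus>\<^bsub>R\<^esub> y \<in> M"
    and "\<And>a x. a \<in> base \<Longrightarrow> x \<in> M \<Longrightarrow> a \<otimes>\<^bsub>R\<^esub> x \<in> M"
    and "\<And>a x. a \<in> base \<Longrightarrow> x \<in> M \<Longrightarrow> x \<otimes>\<^bsub>R\<^esub> a \<in> M"
proof -
  interpret M: additive_subgroup M R using assms unfolding sub_bimodule_def by blast
  show "M \<subseteq> carrier R" "\<zero>\<^bsub>R\<^esub> \<in> M" using M.a_subset by auto
  show "x \<oplus>\<^bsub>R\<^esub> y \<in> M" if "x \<in> M" "y \<in> M" for x y using that by simp
  show "x \<ominus>\<^bsub>R\<^esub> y \<in> M" if "x \<in> M" "y \<in> M" for x y using that by (simp add: a_minus_def)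
  show "a \<otimes>\<^bsub>R\<^esub> x \<in> M" "x \<otimes>\<^bsub>R\<^esub> a \<in> M" if "a \<in> base" "x \<in> M" for a x
    using assms that unfolding sub_bimodule_def by blast+
qed

lemma sub_bimodule_inter:
  assumes M: "sub_bimodule R base M" and N: "sub_bimodule R base N"
  shows "sub_bimodule R base (M \<inter> N)"
proof (rule sub_bimoduleI)
  show "M \<inter> N \<subseteq> carrier R" using sub_bimoduleD(1)[OF M] by blast
  show "\<zero>\<^bsub>R\<^esub> \<in> M \<inter> N" using sub_bimoduleD(2)[OF M] sub_bimoduleD(2)[OF N] by blast
  show "x \<oplus>\<^bsub>R\<^esub> y \<in> M \<inter> N" if "x \<in> M \<inter> N" "y \<in> M \<inter> N" for x y
    using that sub_bimoduleD(3)[OF M, of x y] sub_bimoduleD(3)[OF N, of x y] by blast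
  show "a \<otimes>\<^bsub>R\<^esub> x \<in> M \<inter> N \<and> x \<otimes>\<^bsub>R\<^esub> a \<in> M \<inter> N" if "a \<in> base" "x \<in> M \<inter> N" for a x
    using that sub_bimoduleD(5,6)[OF M, of a x] sub_bimoduleD(5,6)[OF N, of a x] by blast
qed

text \<open>This reduces simplicity of the base ring to a condition on sub-bimodules of \<open>R\<close>, so that
  ideals and components are handled by the same lemmas.\<close>

lemma ideal_base_iff:
  "ideal I (base_ring G R C) \<longleftrightarrow> I \<subseteq> base \<and> sub_bimodule R base I"
proof
  interpret B: ring "base_ring G R C" by (rule ring_base)
  {
    assume "ideal I (base_ring G R C)"
    then interpret I: ideal I "base_ring G R C" .
    have sub: "I \<subseteq> base" using I.a_subset by simp
    have "sub_bimodule R base I"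
    proof (rule sub_bimoduleI)
      show "I \<subseteq> carrier R" using sub base_closed by blast
      show "\<zero>\<^bsub>R\<^esub> \<in> I" using I.zero_closed by simp
      show "x \<oplus>\<^bsub>R\<^esub> y \<in> I" if "x \<in> I" "y \<in> I" for x y
        using I.a_closed that by simp
      show "a \<otimes>\<^bsub>R\<^esub> x \<in> I \<and> x \<otimes>\<^bsub>R\<^esub> a \<in> I" if "a \<in> base" "x \<in> I" for a x
        using I.I_l_closed[of x a] I.I_r_closed[of x a] that by simp
    qed
    then show "I \<subseteq> base \<and> sub_bimodule R base I" using sub by blast
  next
    assume I: "I \<subseteq> base \<and> sub_bimodule R base I"
    note D = sub_bimoduleD[OF conjunct2[OF I]]
    have minus: "\<ominus>\<^bsub>base_ring G R C\<^esub> x \<in> I" if "x \<in> I" for x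
    proof -
      have "\<ominus>\<^bsub>base_ring G R C\<^esub> x = \<ominus>\<^bsub>base_ring G R C\<^esub> \<one>\<^bsub>R\<^esub> \<otimes>\<^bsub>R\<^esub> x"
        using B.l_minus[OF B.one_closed, of x] B.l_one[of x] that I by auto
      moreover have "\<ominus>\<^bsub>base_ring G R C\<^esub> \<one>\<^bsub>R\<^esub> \<in> base"
        using B.a_inv_closed[OF B.one_closed] by simp
      ultimately show ?thesis using D(5) that by simp
    qed
    show "ideal I (base_ring G R C)"
    proof (rule idealI)
      show "subgroup I (add_monoid (base_ring G R C))"
        by (rule B.add.subgroupI) (use I D minus in \<open>auto simp: a_inv_def\<close>)
    qed (use ring_base D in auto)
  }
qed

section \<open>Sums of components as sub-bimodules\<close>

text \<open>Membership in a sum of components becomes a condition on single components, which behaves well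
  under all operations.\<close>

lemma part_eq:
  assumes H: "H \<subseteq> carrier G"
  shows "part R C H = {r \<in> carrier R. \<forall>g\<in>carrier G - H. component g r = \<zero>\<^bsub>R\<^esub>}"
proof
  show "part R C H \<subseteq> {r \<in> carrier R. \<forall>g\<in>carrier G - H. component g r = \<zero>\<^bsub>R\<^esub>}"
  proof
    fix r assume "r \<in> part R C H"
    then obtain F x where F: "finite F" "F \<subseteq> H" "x \<in> (\<Pi> h\<in>F. C h)" and r: "r = finsum R x F"
      unfolding part_def by blast
    have FG: "F \<subseteq> carrier G" using F H by blast
    show "r \<in> {r \<in> carrier R. \<forall>g\<in>carrier G - H. component g r = \<zero>\<^bsub>R\<^esub>}"
      using r F component_finsum[OF F(1) FG F(3)] R.finsum_closed[OF components_Pi_closed[OF FG F(3)]]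
      by auto
  qed
  show "{r \<in> carrier R. \<forall>g\<in>carrier G - H. component g r = \<zero>\<^bsub>R\<^esub>} \<subseteq> part R C H"
  proof
    fix r assume r: "r \<in> {r \<in> carrier R. \<forall>g\<in>carrier G - H. component g r = \<zero>\<^bsub>R\<^esub>}"
    then have sup: "support r \<subseteq> H" "support r \<subseteq> carrier G" unfolding support_def by auto
    have "r = finsum R (\<lambda>g. component g r) (support r)"
      using finsum_component[of r "support r"] finite_support sup r by simp
    moreover have "(\<lambda>g. component g r) \<in> (\<Pi> h\<in>support r. C h)"
      using r sup component_in by auto
    ultimately show "r \<in> part R C H"
      unfolding part_def using sup finite_support[of r] r by blast
  qed
qed

lemma sub_bimodule_part:
  assumes H: "H \<subseteq> carrier G"
  shows "sub_bimodule R base (part R C H)"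
  unfolding part_eq[OF H]
  by (rule sub_bimoduleI)
    (auto simp: component_of_zero component_of_sum component_of_base_left component_of_base_right
      base_closed)

lemma component_subset_part:
  assumes "H \<subseteq> carrier G" "h \<in> H"
  shows "C h \<subseteq> part R C H"
  using assms component_homogeneous[of h] component_closed[of h] by (auto simp: part_eq)

lemma part_singleton:
  assumes g: "g \<in> carrier G"
  shows "part R C {g} = C g"
proof
  show "part R C {g} \<subseteq> C g"
  proof
    fix r assume "r \<in> part R C {g}"
    then have r: "r \<in> carrier R" and z: "\<And>h. h \<in> carrier G \<Longrightarrow> h \<noteq> g \<Longrightarrow> component h r = \<zero>\<^bsub>R\<^esub>"
      using g by (auto simp: part_eq)
    have "r = component g r"
      by (rule component_eqI)
        (use r z g component_carrier component_homogeneous[OF g component_in[OF r g]] in auto)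
    then show "r \<in> C g" using component_in[OF r g] by simp
  qed
  show "C g \<subseteq> part R C {g}" using component_subset_part g by simp
qed

lemma part_empty: "part R C {} = {\<zero>\<^bsub>R\<^esub>}"
  unfolding part_def by auto

lemma part_subset_sub_bimodule:
  assumes M: "sub_bimodule R base M" and H: "H \<subseteq> carrier G" "\<And>h. h \<in> H \<Longrightarrow> C h \<subseteq> M"
  shows "part R C H \<subseteq> M"
proof
  fix r assume "r \<in> part R C H"
  then obtain F x where F: "finite F" "F \<subseteq> H" "x \<in> (\<Pi> h\<in>F. C h)" and r: "r = finsum R x F"
    unfolding part_def by blast
  have "finsum R x F \<in> M" using F
  proof (induction F rule: finite_induct)
    case empty
    then show ?case using sub_bimoduleD(2)[OF M] by simp
  next
    case (insert h F)
    have m: "x h \<in> M" "x \<in> F \<rightarrow> carrier R"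
      using insert.prems H components_Pi_closed[of F x] by auto
    then show ?case
      using insert sub_bimoduleD(1,3)[OF M] by auto
  qed
  then show "r \<in> M" using r by simp
qed

lemma centre_base: "centre (base_ring G R C) = base \<inter> centralizer R base"
  unfolding centre_def centralizer_def using base_closed by auto

lemma simple_base_iff:
  "simple_ring (base_ring G R C) \<longleftrightarrow>
     base \<noteq> {\<zero>\<^bsub>R\<^esub>} \<and> (\<forall>I. I \<subseteq> base \<longrightarrow> sub_bimodule R base I \<longrightarrow> I = {\<zero>\<^bsub>R\<^esub>} \<or> I = base)"
  unfolding simple_ring_def using ring_base by (auto simp: ideal_base_iff)

lemma bimodule_isomorphic_sym:
  assumes M: "sub_bimodule R base M"
    and iso: "bimodule_isomorphic R base M N"
  shows "bimodule_isomorphic R base N M"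
proof -
  obtain f where bij: "bij_betw f M N"
    and add: "\<And>x y. x \<in> M \<Longrightarrow> y \<in> M \<Longrightarrow> f (x \<oplus>\<^bsub>R\<^esub> y) = f x \<oplus>\<^bsub>R\<^esub> f y"
    and mult: "\<And>a x. a \<in> base \<Longrightarrow> x \<in> M \<Longrightarrow> f (a \<otimes>\<^bsub>R\<^esub> x) = a \<otimes>\<^bsub>R\<^esub> f x \<and> f (x \<otimes>\<^bsub>R\<^esub> a) = f x \<otimes>\<^bsub>R\<^esub> a"
    using iso unfolding bimodule_isomorphic_def bimodule_iso_def by blast
  let ?h = "the_inv_into M f"
  have inj: "inj_on f M" and im: "f ` M = N" using bij unfolding bij_betw_def by blast+
  have h: "?h y \<in> M" "f (?h y) = y" if "y \<in> N" for y
    using that im the_inv_into_into[OF inj, of y M] f_the_inv_into_f[OF inj, of y] by simp_all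
  have eq: "?h y = x" if "x \<in> M" "f x = y" for x y
    using the_inv_into_f_eq[OF inj that(2,1)] .
  note D = sub_bimoduleD[OF M]
  have "?h \<in> bimodule_iso R base N M"
    unfolding bimodule_iso_def
  proof (intro CollectI conjI ballI)
    show "bij_betw ?h N M" using bij_betw_the_inv_into[OF bij] .
    show "?h (x \<oplus>\<^bsub>R\<^esub> y) = ?h x \<oplus>\<^bsub>R\<^esub> ?h y" if "x \<in> N" "y \<in> N" for x y
      using eq[OF D(3)[OF h(1)[OF that(1)] h(1)[OF that(2)]]]
        add[OF h(1)[OF that(1)] h(1)[OF that(2)]] h(2)[OF that(1)] h(2)[OF that(2)] by simp
    fix a x assume a: "a \<in> base" and x: "x \<in> N"
    show "?h (a \<otimes>\<^bsub>R\<^esub> x) = a \<otimes>\<^bsub>R\<^esub> ?h x"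
      by (rule eq[OF D(5)[OF a h(1)[OF x]]]) (simp add: mult[OF a h(1)[OF x]] h(2)[OF x])
    show "?h (x \<otimes>\<^bsub>R\<^esub> a) = ?h x \<otimes>\<^bsub>R\<^esub> a"
      by (rule eq[OF D(6)[OF a h(1)[OF x]]]) (simp add: mult[OF a h(1)[OF x]] h(2)[OF x])
  qed
  then show ?thesis unfolding bimodule_isomorphic_def by blast
qed

lemma bimodule_isomorphic_refl: "bimodule_isomorphic R A M M"
proof -
  have "id \<in> bimodule_iso R A M M" unfolding bimodule_iso_def by auto
  then show ?thesis unfolding bimodule_isomorphic_def by blast
qed

section \<open>Conjugation by homogeneous units\<close>

lemma conjugation_iso:
  assumes g: "g \<in> carrier G" and u: "u \<in> C g" "u \<in> Units R"
  shows "(\<lambda>a. u \<otimes>\<^bsub>R\<^esub> a \<otimes>\<^bsub>R\<^esub> inv\<^bsub>R\<^esub> u) \<in> ring_iso (base_ring G R C) (base_ring G R C)"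
proof -
  have c: "u \<in> carrier R" "inv\<^bsub>R\<^esub> u \<in> carrier R" using u by auto
  have cancel: "inv\<^bsub>R\<^esub> u \<otimes>\<^bsub>R\<^esub> (u \<otimes>\<^bsub>R\<^esub> x) = x" "u \<otimes>\<^bsub>R\<^esub> (inv\<^bsub>R\<^esub> u \<otimes>\<^bsub>R\<^esub> x) = x" if "x \<in> carrier R" for x
    using that c u by (simp_all add: R.m_assoc[symmetric])
  have "(\<lambda>a. u \<otimes>\<^bsub>R\<^esub> a \<otimes>\<^bsub>R\<^esub> inv\<^bsub>R\<^esub> u) \<in> ring_hom (base_ring G R C) (base_ring G R C)"
    by (rule ring_hom_memI)
      (use c u base_closed conjugate_in_base[OF g u] in
        \<open>auto simp: R.m_assoc cancel R.l_distr R.r_distr\<close>)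
  moreover have "bij_betw (\<lambda>a. u \<otimes>\<^bsub>R\<^esub> a \<otimes>\<^bsub>R\<^esub> inv\<^bsub>R\<^esub> u) base base"
    by (rule bij_betwI[of _ _ _ "\<lambda>a. inv\<^bsub>R\<^esub> u \<otimes>\<^bsub>R\<^esub> a \<otimes>\<^bsub>R\<^esub> u"])
      (use c u base_closed conjugate_in_base[OF g u] in \<open>auto simp: R.m_assoc cancel\<close>)
  ultimately show ?thesis unfolding ring_iso_def by simp
qed

text \<open>Right multiplication by \<open>w\<close> is the isomorphism; it respects the right action because \<open>w\<close> commutes
  with the base ring.\<close>

lemma commuting_unit_imp_isomorphic:
  assumes g: "g \<in> carrier G" and w: "w \<in> C g" "w \<in> Units R"
    and comm: "\<And>a. a \<in> base \<Longrightarrow> a \<otimes>\<^bsub>R\<^esub> w = w \<otimes>\<^bsub>R\<^esub> a"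
  shows "bimodule_isomorphic R base base (C g)"
proof -
  have c: "w \<in> carrier R" "inv\<^bsub>R\<^esub> w \<in> carrier R" using w by auto
  have "bij_betw (\<lambda>x. x \<otimes>\<^bsub>R\<^esub> w) base (C g)"
  proof (rule bij_betwI)
    show "(\<lambda>x. x \<otimes>\<^bsub>R\<^esub> w) \<in> base \<rightarrow> C g" using base_module_component g w by auto
    show "(\<lambda>x. x \<otimes>\<^bsub>R\<^esub> inv\<^bsub>R\<^esub> w) \<in> C g \<rightarrow> base"
      using component_prod[of g "inv\<^bsub>G\<^esub> g" _ "inv\<^bsub>R\<^esub> w"] inv_homogeneous[OF g w] g by auto
    show "x \<otimes>\<^bsub>R\<^esub> w \<otimes>\<^bsub>R\<^esub> inv\<^bsub>R\<^esub> w = x" if "x \<in> base" for x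
      using that base_closed c w by (simp add: R.m_assoc)
    show "x \<otimes>\<^bsub>R\<^esub> inv\<^bsub>R\<^esub> w \<otimes>\<^bsub>R\<^esub> w = x" if "x \<in> C g" for x
      using that component_closed[OF g] c w by (simp add: R.m_assoc)
  qed
  then have "(\<lambda>x. x \<otimes>\<^bsub>R\<^esub> w) \<in> bimodule_iso R base base (C g)"
    unfolding bimodule_iso_def using base_closed c
    by (auto simp: R.l_distr R.m_assoc comm[symmetric])
  then show ?thesis unfolding bimodule_isomorphic_def by blast
qed

text \<open>The hypothesis says that \<open>y\<close> transforms under \<open>R\<^sub>e\<close> like \<open>u\<close>. Then \<open>u\<^sup>-\<^sup>1 y\<close> centralizes \<open>R\<^sub>e\<close>, so it lies
  in \<open>R\<^sub>e\<close>, and \<open>y = u (u\<^sup>-\<^sup>1 y)\<close> has degree \<open>g\<close>.\<close>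

lemma intertwiner_homogeneous:
  assumes cen: "centralizer R base \<subseteq> base"
    and g: "g \<in> carrier G" and u: "u \<in> C g" "u \<in> Units R" and y: "y \<in> carrier R"
    and tw: "\<And>a. a \<in> base \<Longrightarrow> (u \<otimes>\<^bsub>R\<^esub> a \<otimes>\<^bsub>R\<^esub> inv\<^bsub>R\<^esub> u) \<otimes>\<^bsub>R\<^esub> y = y \<otimes>\<^bsub>R\<^esub> a"
  shows "y \<in> C g"
proof -
  let ?z = "inv\<^bsub>R\<^esub> u \<otimes>\<^bsub>R\<^esub> y"
  have c: "u \<in> carrier R" "inv\<^bsub>R\<^esub> u \<in> carrier R" "?z \<in> carrier R" using u y by auto
  have cancel: "inv\<^bsub>R\<^esub> u \<otimes>\<^bsub>R\<^esub> (u \<otimes>\<^bsub>R\<^esub> x) = x" if "x \<in> carrier R" for x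
    using that c u by (simp add: R.m_assoc[symmetric])
  have "?z \<otimes>\<^bsub>R\<^esub> a = a \<otimes>\<^bsub>R\<^esub> ?z" if a: "a \<in> base" for a
  proof -
    have ac: "a \<in> carrier R" using base_closed a .
    have "?z \<otimes>\<^bsub>R\<^esub> a = inv\<^bsub>R\<^esub> u \<otimes>\<^bsub>R\<^esub> ((u \<otimes>\<^bsub>R\<^esub> a \<otimes>\<^bsub>R\<^esub> inv\<^bsub>R\<^esub> u) \<otimes>\<^bsub>R\<^esub> y)"
      using tw[OF a] ac c y by (simp add: R.m_assoc)
    also have "... = a \<otimes>\<^bsub>R\<^esub> ?z"
      using ac c y cancel by (simp add: R.m_assoc)
    finally show ?thesis .
  qed
  then have "?z \<in> base" using cen c unfolding centralizer_def by blast
  then have "u \<otimes>\<^bsub>R\<^esub> ?z \<in> C g" using base_module_component g u by blast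
  moreover have "u \<otimes>\<^bsub>R\<^esub> ?z = y" using u y c by (simp add: R.m_assoc[symmetric])
  ultimately show ?thesis by simp
qed

end

section \<open>The equivalence\<close>

context crossed_product
begin

lemma obtain_unit:
  assumes "g \<in> carrier G"
  obtains u where "u \<in> C g" "u \<in> Units R"
  using component_unit[OF assms] by blast

lemma unit_nonzero: "\<one>\<^bsub>R\<^esub> \<noteq> \<zero>\<^bsub>R\<^esub> \<Longrightarrow> u \<in> Units R \<Longrightarrow> u \<noteq> \<zero>\<^bsub>R\<^esub>"
  by (metis R.Units_inv_closed R.Units_r_inv R.l_null)

text \<open>The \<open>g\<close>-components of the elements of \<open>N\<close>, divided by a unit of degree \<open>g\<close>, form a nonzero
  ideal of the simple ring \<open>R\<^sub>e\<close>, so they fill \<open>R\<^sub>g\<close>.\<close>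

lemma component_attains_all:
  assumes simple: "simple_ring (base_ring G R C)"
    and N: "sub_bimodule R base N" and d: "d \<in> N" and g: "g \<in> carrier G"
    and dg: "component g d \<noteq> \<zero>\<^bsub>R\<^esub>" and c: "c \<in> C g"
  obtains d' where "d' \<in> N" "component g d' = c"
proof -
  obtain u where u: "u \<in> C g" "u \<in> Units R" using obtain_unit[OF g] .
  have uc: "u \<in> carrier R" "inv\<^bsub>R\<^esub> u \<in> carrier R" using u by auto
  note D = sub_bimoduleD[OF N]
  have NR: "x \<in> carrier R" if "x \<in> N" for x using D(1) that by blast
  define I where "I = {x \<in> base. \<exists>d\<in>N. component g d = x \<otimes>\<^bsub>R\<^esub> u}"
  have strip: "x \<otimes>\<^bsub>R\<^esub> inv\<^bsub>R\<^esub> u \<in> base \<and> x \<otimes>\<^bsub>R\<^esub> inv\<^bsub>R\<^esub> u \<otimes>\<^bsub>R\<^esub> u = x" if "x \<in> C g" for x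
    using component_prod[of g "inv\<^bsub>G\<^esub> g" x "inv\<^bsub>R\<^esub> u"] inv_homogeneous[OF g u] g that
      component_closed[OF g that] uc u by (simp add: R.m_assoc)
  have "sub_bimodule R base I"
  proof (rule sub_bimoduleI)
    show "I \<subseteq> carrier R" unfolding I_def using base_closed by blast
    have "component g \<zero>\<^bsub>R\<^esub> = \<zero>\<^bsub>R\<^esub> \<otimes>\<^bsub>R\<^esub> u" using component_of_zero[OF g] uc by simp
    then show "\<zero>\<^bsub>R\<^esub> \<in> I" unfolding I_def using component_zero[OF G.one_closed] D(2) by blast
    show "x \<oplus>\<^bsub>R\<^esub> y \<in> I" if xy: "x \<in> I" "y \<in> I" for x y
    proof -
      obtain d e where de: "x \<in> base" "y \<in> base" "d \<in> N" "e \<in> N"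
        "component g d = x \<otimes>\<^bsub>R\<^esub> u" "component g e = y \<otimes>\<^bsub>R\<^esub> u"
        using xy unfolding I_def by blast
      have "component g (d \<oplus>\<^bsub>R\<^esub> e) = (x \<oplus>\<^bsub>R\<^esub> y) \<otimes>\<^bsub>R\<^esub> u"
        using de component_of_sum[OF NR NR g] base_closed uc by (simp add: R.l_distr)
      then show ?thesis 
        unfolding I_def using D(3)[OF de(3,4)] component_add[OF _ de(1,2)] by blast
    qed
    show "a \<otimes>\<^bsub>R\<^esub> x \<in> I \<and> x \<otimes>\<^bsub>R\<^esub> a \<in> I" if a: "a \<in> base" and x: "x \<in> I" for a x
    proof -
      obtain d where d: "x \<in> base" "d \<in> N" "component g d = x \<otimes>\<^bsub>R\<^esub> u"
        using x unfolding I_def by blast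
      have ac: "a \<in> carrier R" and xc: "x \<in> carrier R" using a d base_closed by auto
      have "component g (a \<otimes>\<^bsub>R\<^esub> d) = (a \<otimes>\<^bsub>R\<^esub> x) \<otimes>\<^bsub>R\<^esub> u"
        using component_of_base_left[OF a NR[OF d(2)] g] d ac xc uc by (simp add: R.m_assoc)
      then have 1: "a \<otimes>\<^bsub>R\<^esub> x \<in> I"
        unfolding I_def using D(5)[OF a d(2)] base_mult[OF a d(1)] by blast
      \<comment> \<open>Moving \<open>a\<close> past \<open>u\<close> conjugates it, so \<open>d\<close> is multiplied by the conjugate instead.\<close>
      let ?b = "inv\<^bsub>R\<^esub> u \<otimes>\<^bsub>R\<^esub> a \<otimes>\<^bsub>R\<^esub> u"
      have b: "?b \<in> base" using conjugate_in_base(2)[OF g u a] .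
      have "u \<otimes>\<^bsub>R\<^esub> ?b = a \<otimes>\<^bsub>R\<^esub> u" using ac uc u by (simp add: R.m_assoc[symmetric])
      then have "component g (d \<otimes>\<^bsub>R\<^esub> ?b) = (x \<otimes>\<^bsub>R\<^esub> a) \<otimes>\<^bsub>R\<^esub> u"
        using component_of_base_right[OF b NR[OF d(2)] g] d ac xc uc by (simp add: R.m_assoc)
      then have 2: "x \<otimes>\<^bsub>R\<^esub> a \<in> I"
        unfolding I_def using D(6)[OF b d(2)] base_mult[OF d(1) a] by blast
      show ?thesis using 1 2 by blast
    qed
  qed
  moreover have "I \<subseteq> base" unfolding I_def by blast
  moreover have "I \<noteq> {\<zero>\<^bsub>R\<^esub>}"
  proof -
    have x: "component g d \<otimes>\<^bsub>R\<^esub> inv\<^bsub>R\<^esub> u \<in> base" "component g d \<otimes>\<^bsub>R\<^esub> inv\<^bsub>R\<^esub> u \<otimes>\<^bsub>R\<^esub> u = component g d"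
      using strip[OF component_in[OF NR[OF d] g]] by blast+
    have "component g d \<otimes>\<^bsub>R\<^esub> inv\<^bsub>R\<^esub> u \<in> I"
      unfolding I_def using x(1) x(2)[symmetric] d by blast
    moreover have "component g d \<otimes>\<^bsub>R\<^esub> inv\<^bsub>R\<^esub> u \<noteq> \<zero>\<^bsub>R\<^esub>"
      using x(2) dg uc by auto
    ultimately show ?thesis by blast
  qed
  ultimately have "I = base" using simple unfolding simple_base_iff by blast
  then have "c \<otimes>\<^bsub>R\<^esub> inv\<^bsub>R\<^esub> u \<in> I" using strip[OF c] by simp
  then show thesis using that strip[OF c] unfolding I_def by auto
qed

text \<open>A minimal support argument. Choose \<open>n\<close> in \<open>M\<close> of least support among the elements with
  \<open>g\<close>-component \<open>u\<close>. The element \<open>(u a u\<^sup>-\<^sup>1) n - n a\<close> has no \<open>g\<close>-component. If it had some other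
  component, of degree \<open>k\<close>, then the preceding lemma would give an element of \<open>M\<close> without
  \<open>g\<close>-component, supported where \<open>n\<close> is, and with the same \<open>k\<close>-component as \<open>n\<close>; subtracting it from
  \<open>n\<close> would make the support smaller. So \<open>n\<close> transforms like \<open>u\<close> and is homogeneous.\<close>

lemma component_subset_sub_bimodule:
  assumes simple: "simple_ring (base_ring G R C)" and cen: "centralizer R base \<subseteq> base"
    and M: "sub_bimodule R base M" and m: "m \<in> M" and g: "g \<in> carrier G"
    and mg: "component g m \<noteq> \<zero>\<^bsub>R\<^esub>"
  shows "C g \<subseteq> M"
proof -
  obtain u where u: "u \<in> C g" "u \<in> Units R" using obtain_unit[OF g] .
  have uc: "u \<in> carrier R" "inv\<^bsub>R\<^esub> u \<in> carrier R" using u by auto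
  note D = sub_bimoduleD[OF M]
  define P where "P n \<longleftrightarrow> n \<in> M \<and> component g n = u" for n
  obtain n0 where "n0 \<in> M" "component g n0 = u"
    using component_attains_all[OF simple M m g mg u(1)] .
  then obtain n where n: "n \<in> M" "component g n = u"
    and min: "\<And>n'. n' \<in> M \<Longrightarrow> component g n' = u \<Longrightarrow> card (support n) \<le> card (support n')"
    using ex_has_least_nat[of P n0 "\<lambda>n. card (support n)"] unfolding P_def by auto
  have nR: "n \<in> carrier R" using n D(1) by blast
  have tw: "(u \<otimes>\<^bsub>R\<^esub> a \<otimes>\<^bsub>R\<^esub> inv\<^bsub>R\<^esub> u) \<otimes>\<^bsub>R\<^esub> n = n \<otimes>\<^bsub>R\<^esub> a" if a: "a \<in> base" for a
  proof -
    define s where "s = u \<otimes>\<^bsub>R\<^esub> a \<otimes>\<^bsub>R\<^esub> inv\<^bsub>R\<^esub> u"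
    have s: "s \<in> base" unfolding s_def using conjugate_in_base(1)[OF g u a] .
    have ac: "a \<in> carrier R" "s \<in> carrier R" using a s base_closed by auto
    have su: "s \<otimes>\<^bsub>R\<^esub> u = u \<otimes>\<^bsub>R\<^esub> a" unfolding s_def using ac uc u by (simp add: R.m_assoc)
    define d where "d = s \<otimes>\<^bsub>R\<^esub> n \<ominus>\<^bsub>R\<^esub> n \<otimes>\<^bsub>R\<^esub> a"
    have dM: "d \<in> M"
      unfolding d_def using D(4)[OF D(5)[OF s n(1)] D(6)[OF a n(1)]] .
    have dR: "d \<in> carrier R" using dM D(1) by blast
    have comp_d: "component k d = s \<otimes>\<^bsub>R\<^esub> component k n \<ominus>\<^bsub>R\<^esub> component k n \<otimes>\<^bsub>R\<^esub> a"
      if k: "k \<in> carrier G" for k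
      unfolding d_def
      using component_of_diff[OF _ _ k, of "s \<otimes>\<^bsub>R\<^esub> n" "n \<otimes>\<^bsub>R\<^esub> a"] component_of_base_left[OF s nR k]
        component_of_base_right[OF a nR k] ac nR by simp
    have dg: "component g d = \<zero>\<^bsub>R\<^esub>"
      using comp_d[OF g] n(2) su ac uc by (simp add: a_minus_def R.r_neg)
    have d0: "component k d = \<zero>\<^bsub>R\<^esub>" if "k \<in> carrier G" "component k n = \<zero>\<^bsub>R\<^esub>" for k
      using comp_d[OF that(1)] that(2) ac by (simp add: a_minus_def)
    have "component k d = \<zero>\<^bsub>R\<^esub>" if k: "k \<in> carrier G" for k
    proof (rule ccontr)
      assume dk: "component k d \<noteq> \<zero>\<^bsub>R\<^esub>"
      \<comment> \<open>Elements of \<open>M\<close> supported in \<open>H\<close> can be subtracted from \<open>n\<close> without changing its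
        \<open>g\<close>-component and without enlarging its support.\<close>
      define H where "H = support n - {g}"
      have H: "H \<subseteq> carrier G" unfolding H_def support_def by blast
      let ?N = "M \<inter> part R C H"
      have N: "sub_bimodule R base ?N"
        using sub_bimodule_inter[OF M sub_bimodule_part[OF H]] .
      have "component j d = \<zero>\<^bsub>R\<^esub>" if "j \<in> carrier G - H" for j
        using that dg d0 unfolding H_def support_def by auto
      then have dN: "d \<in> ?N" using dM dR part_eq[OF H] by blast
      obtain d' where d': "d' \<in> ?N" "component k d' = component k n"
        using component_attains_all[OF simple N dN k dk component_in[OF nR k]] .
      have d'R: "d' \<in> carrier R" using d' D(1) by blast
      have d'0: "component j d' = \<zero>\<^bsub>R\<^esub>" if "j \<in> carrier G" "j \<notin> H" for j
        using d'(1) that unfolding part_eq[OF H] by blast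
      define n' where "n' = n \<ominus>\<^bsub>R\<^esub> d'"
      have n'M: "n' \<in> M" unfolding n'_def using D(4)[OF n(1)] d'(1) by blast
      have comp_n': "component j n' = component j n \<ominus>\<^bsub>R\<^esub> component j d'" if "j \<in> carrier G" for j
        unfolding n'_def using component_of_diff[OF nR d'R that] .
      have "component g d' = \<zero>\<^bsub>R\<^esub>" using d'0[OF g] unfolding H_def by blast
      then have n'g: "component g n' = u"
        using comp_n'[OF g] n(2) uc by (simp add: a_minus_def)
      have n'0: "component j n' = \<zero>\<^bsub>R\<^esub>" if "j \<in> carrier G" "component j n = \<zero>\<^bsub>R\<^esub>" for j
      proof -
        have "component j d' = \<zero>\<^bsub>R\<^esub>" using d'0[OF that(1)] that(2) unfolding H_def support_def by blast
        then show ?thesis using comp_n'[OF that(1)] that(2) by (simp add: a_minus_def)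
      qed
      have n'k: "component k n' = \<zero>\<^bsub>R\<^esub>"
        using comp_n'[OF k] d'(2) component_carrier[OF nR k] by (simp add: a_minus_def R.r_neg)
      have "support n' \<subseteq> support n" using n'0 unfolding support_def by blast
      moreover have "k \<in> support n" "k \<notin> support n'"
        using d0[OF k] dk k n'k unfolding support_def by blast+
      ultimately have "support n' \<subset> support n" by blast
      then have "card (support n') < card (support n)"
        using psubset_card_mono[OF finite_support[OF nR]] by blast
      then show False using min[OF n'M n'g] by simp
    qed
    then have "d = \<zero>\<^bsub>R\<^esub>"
      using component_eqI[OF dR R.zero_closed] component_of_zero by simp
    then show ?thesis
      using R.r_right_minus_eq[of "s \<otimes>\<^bsub>R\<^esub> n" "n \<otimes>\<^bsub>R\<^esub> a"] ac nR unfolding d_def s_def by simp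
  qed
  have "n \<in> C g" using intertwiner_homogeneous[OF cen g u nR tw] .
  then have "n = u" using component_homogeneous[OF g _ g, of n] n by simp
  then have uM: "u \<in> M" using n by simp
  show ?thesis
  proof
    fix c assume c: "c \<in> C g"
    have "c \<otimes>\<^bsub>R\<^esub> inv\<^bsub>R\<^esub> u \<in> base"
      using component_prod[of g "inv\<^bsub>G\<^esub> g" c "inv\<^bsub>R\<^esub> u"] inv_homogeneous[OF g u] g c by simp
    then have "(c \<otimes>\<^bsub>R\<^esub> inv\<^bsub>R\<^esub> u) \<otimes>\<^bsub>R\<^esub> u \<in> M" using D(5)[OF _ uM] by blast
    then show "c \<in> M" using component_closed[OF g c] uc u by (simp add: R.m_assoc)
  qed
qed

text \<open>An isomorphism sends a unit \<open>u\<close> of degree \<open>s\<close> to a nonzero element that transforms like \<open>u\<close>, hence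
  again of degree \<open>s\<close>; so \<open>s\<close> occurs in the target.\<close>

lemma isomorphic_parts_subset:
  assumes nz: "\<one>\<^bsub>R\<^esub> \<noteq> \<zero>\<^bsub>R\<^esub>" and cen: "centralizer R base \<subseteq> base"
    and S: "S \<subseteq> carrier G" and T: "T \<subseteq> carrier G"
    and iso: "bimodule_isomorphic R base (part R C S) (part R C T)"
  shows "S \<subseteq> T"
proof
  fix s assume s: "s \<in> S"
  obtain f where bij: "bij_betw f (part R C S) (part R C T)"
    and add: "\<And>x y. x \<in> part R C S \<Longrightarrow> y \<in> part R C S \<Longrightarrow> f (x \<oplus>\<^bsub>R\<^esub> y) = f x \<oplus>\<^bsub>R\<^esub> f y"
    and mult: "\<And>a x. a \<in> base \<Longrightarrow> x \<in> part R C S \<Longrightarrow>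
      f (a \<otimes>\<^bsub>R\<^esub> x) = a \<otimes>\<^bsub>R\<^esub> f x \<and> f (x \<otimes>\<^bsub>R\<^esub> a) = f x \<otimes>\<^bsub>R\<^esub> a"
    using iso unfolding bimodule_isomorphic_def bimodule_iso_def by blast
  have sG: "s \<in> carrier G" using s S by blast
  obtain u where u: "u \<in> C s" "u \<in> Units R" using obtain_unit[OF sG] .
  have uc: "u \<in> carrier R" "inv\<^bsub>R\<^esub> u \<in> carrier R" using u by auto
  have uS: "u \<in> part R C S" using component_subset_part[OF S s] u by blast
  have zS: "\<zero>\<^bsub>R\<^esub> \<in> part R C S" using sub_bimoduleD(2)[OF sub_bimodule_part[OF S]] .
  have fT: "f x \<in> part R C T" if "x \<in> part R C S" for x using bij that bij_betwE by blast
  have fR: "f x \<in> carrier R" if "x \<in> part R C S" for x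
    using fT[OF that] sub_bimoduleD(1)[OF sub_bimodule_part[OF T]] by blast
  have tw: "(u \<otimes>\<^bsub>R\<^esub> a \<otimes>\<^bsub>R\<^esub> inv\<^bsub>R\<^esub> u) \<otimes>\<^bsub>R\<^esub> f u = f u \<otimes>\<^bsub>R\<^esub> a" if a: "a \<in> base" for a
  proof -
    have "(u \<otimes>\<^bsub>R\<^esub> a \<otimes>\<^bsub>R\<^esub> inv\<^bsub>R\<^esub> u) \<otimes>\<^bsub>R\<^esub> u = u \<otimes>\<^bsub>R\<^esub> a"
      using uc u base_closed[OF a] by (simp add: R.m_assoc)
    then show ?thesis
      using mult[OF conjugate_in_base(1)[OF sG u a] uS] mult[OF a uS] by simp
  qed
  have fs: "f u \<in> C s" using intertwiner_homogeneous[OF cen sG u fR[OF uS] tw] .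
  have "f \<zero>\<^bsub>R\<^esub> = \<zero>\<^bsub>R\<^esub>" using add[OF zS zS] fR[OF zS] by simp
  then have "f u \<noteq> \<zero>\<^bsub>R\<^esub>"
    using bij uS zS unit_nonzero[OF nz u(2)] unfolding bij_betw_def inj_on_def by metis
  then have "component s (f u) \<noteq> \<zero>\<^bsub>R\<^esub>" using component_homogeneous[OF sG fs sG] by simp
  then show "s \<in> T" using fT[OF uS] sG unfolding part_eq[OF T] by blast
qed

lemma part_inj:
  assumes nz: "\<one>\<^bsub>R\<^esub> \<noteq> \<zero>\<^bsub>R\<^esub>" and S: "S \<subseteq> carrier G" and T: "T \<subseteq> carrier G"
    and eq: "part R C S \<subseteq> part R C T"
  shows "S \<subseteq> T"
proof
  fix s assume s: "s \<in> S"
  then have sG: "s \<in> carrier G" using S by blast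
  obtain u where u: "u \<in> C s" "u \<in> Units R" using obtain_unit[OF sG] .
  have "u \<in> part R C T" using component_subset_part[OF S s] u eq by blast
  moreover have "component s u \<noteq> \<zero>\<^bsub>R\<^esub>"
    using component_homogeneous[OF sG u(1) sG] unit_nonzero[OF nz u(2)] by simp
  ultimately show "s \<in> T" using sG unfolding part_eq[OF T] by blast
qed

lemma controlled_if_simple_centralizer:
  assumes simple: "simple_ring (base_ring G R C)" and cen: "centralizer R base \<subseteq> base"
  shows "controlled G R C"
proof -
  have nz: "\<one>\<^bsub>R\<^esub> \<noteq> \<zero>\<^bsub>R\<^esub>"
  proof
    assume "\<one>\<^bsub>R\<^esub> = \<zero>\<^bsub>R\<^esub>"
    then have "carrier R = {\<zero>\<^bsub>R\<^esub>}" by (rule R.one_zeroD)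
    then have "base = {\<zero>\<^bsub>R\<^esub>}" using base_closed component_zero[OF G.one_closed] by blast
    then show False using simple unfolding simple_base_iff by simp
  qed
  have "bij_betw (part R C) (Pow (carrier G)) {M. sub_bimodule R base M}"
    unfolding bij_betw_def
  proof
    show "inj_on (part R C) (Pow (carrier G))"
    proof (rule inj_onI)
      fix S T assume "S \<in> Pow (carrier G)" "T \<in> Pow (carrier G)" "part R C S = part R C T"
      then show "S = T" using part_inj[OF nz, of S T] part_inj[OF nz, of T S] by simp
    qed
    have "M \<in> part R C ` Pow (carrier G)" if M: "sub_bimodule R base M" for M
    proof -
      let ?H = "{h \<in> carrier G. C h \<subseteq> M}"
      have "component g m = \<zero>\<^bsub>R\<^esub>" if "m \<in> M" "g \<in> carrier G - ?H" for m g
        using component_subset_sub_bimodule[OF simple cen M that(1), of g] that(2) by blast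
      moreover have H: "?H \<subseteq> carrier G" by blast
      ultimately have "M \<subseteq> part R C ?H"
        unfolding part_eq[OF H] using sub_bimoduleD(1)[OF M] by blast
      moreover have "part R C ?H \<subseteq> M" by (rule part_subset_sub_bimodule[OF M]) auto
      ultimately show ?thesis using H by blast
    qed
    then show "part R C ` Pow (carrier G) = {M. sub_bimodule R base M}"
      using sub_bimodule_part by auto
  qed
  moreover have eq: "S = T"
    if S: "S \<subseteq> carrier G" and T: "T \<subseteq> carrier G"
      and iso: "bimodule_isomorphic R base (part R C S) (part R C T)" for S T
    using isomorphic_parts_subset[OF nz cen S T iso]
      isomorphic_parts_subset[OF nz cen T S bimodule_isomorphic_sym[OF sub_bimodule_part[OF S] iso]]
    by (rule subset_antisym)
  ultimately show ?thesis
    unfolding controlled_def by (auto simp: bimodule_isomorphic_refl)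
qed

text \<open>In the zero ring, the empty sum of components and \<open>R\<^sub>e\<close> coincide, although their index sets differ.\<close>

lemma controlled_imp_nonzero:
  assumes "controlled G R C"
  shows "\<one>\<^bsub>R\<^esub> \<noteq> \<zero>\<^bsub>R\<^esub>"
proof
  assume "\<one>\<^bsub>R\<^esub> = \<zero>\<^bsub>R\<^esub>"
  then have "carrier R = {\<zero>\<^bsub>R\<^esub>}" by (rule R.one_zeroD)
  then have "base = {\<zero>\<^bsub>R\<^esub>}" using base_closed component_zero[OF G.one_closed] by blast
  then have "part R C {\<one>\<^bsub>G\<^esub>} = part R C {}"
    using part_singleton[OF G.one_closed] part_empty by simp
  moreover have "inj_on (part R C) (Pow (carrier G))"
    using assms unfolding controlled_def bij_betw_def by blast
  ultimately have "{\<one>\<^bsub>G\<^esub>} = {}"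
    using inj_onD[of "part R C" "Pow (carrier G)" "{\<one>\<^bsub>G\<^esub>}" "{}"] by simp
  then show False by simp
qed

lemma controlled_imp_simple:
  assumes con: "controlled G R C"
  shows "simple_ring (base_ring G R C)"
  unfolding simple_base_iff
proof (intro conjI allI impI)
  have nz: "\<one>\<^bsub>R\<^esub> \<noteq> \<zero>\<^bsub>R\<^esub>" using controlled_imp_nonzero[OF con] .
  then show "base \<noteq> {\<zero>\<^bsub>R\<^esub>}" using one_in_base by auto
  fix I assume I: "I \<subseteq> base" "sub_bimodule R base I"
  have "part R C ` Pow (carrier G) = {M. sub_bimodule R base M}"
    using con unfolding controlled_def by (simp add: bij_betw_imp_surj_on)
  then have "I \<in> part R C ` Pow (carrier G)" using I by simp
  then obtain H where H: "H \<subseteq> carrier G" "I = part R C H" by blast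
  then have "H \<subseteq> {\<one>\<^bsub>G\<^esub>}"
    using part_inj[OF nz H(1), of "{\<one>\<^bsub>G\<^esub>}"] part_singleton[of "\<one>\<^bsub>G\<^esub>"] I by simp
  then have "H = {} \<or> H = {\<one>\<^bsub>G\<^esub>}" by blast
  then show "I = {\<zero>\<^bsub>R\<^esub>} \<or> I = base"
    using H part_empty part_singleton[of "\<one>\<^bsub>G\<^esub>"] by auto
qed

text \<open>If conjugation by \<open>u\<close> agrees on \<open>R\<^sub>e\<close> with conjugation by \<open>v\<close>, then \<open>v\<^sup>-\<^sup>1 u\<close> commutes with \<open>R\<^sub>e\<close> and
  makes \<open>R\<^sub>g\<close> isomorphic to \<open>R\<^sub>e\<close>.\<close>

lemma controlled_imp_outer:
  assumes con: "controlled G R C" and g: "g \<in> carrier G" "g \<noteq> \<one>\<^bsub>G\<^esub>" and u: "u \<in> C g" "u \<in> Units R"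
  shows "outer_aut (base_ring G R C) (\<lambda>a. u \<otimes>\<^bsub>R\<^esub> a \<otimes>\<^bsub>R\<^esub> inv\<^bsub>R\<^esub> u)"
proof -
  have False if inner: "inner_aut (base_ring G R C) (\<lambda>a. u \<otimes>\<^bsub>R\<^esub> a \<otimes>\<^bsub>R\<^esub> inv\<^bsub>R\<^esub> u)"
  proof -
    obtain v where v: "v \<in> Units (base_ring G R C)"
      and eq: "\<And>a. a \<in> base \<Longrightarrow> u \<otimes>\<^bsub>R\<^esub> a \<otimes>\<^bsub>R\<^esub> inv\<^bsub>R\<^esub> u = v \<otimes>\<^bsub>R\<^esub> a \<otimes>\<^bsub>R\<^esub> inv\<^bsub>R\<^esub> v"
      using inner inv_base unfolding inner_aut_def by auto
    have vb: "v \<in> base" "v \<in> Units R" using v Units_base by auto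
    have c: "u \<in> carrier R" "inv\<^bsub>R\<^esub> u \<in> carrier R" "v \<in> carrier R" "inv\<^bsub>R\<^esub> v \<in> carrier R"
      using u vb by auto
    let ?w = "inv\<^bsub>R\<^esub> v \<otimes>\<^bsub>R\<^esub> u"
    have vi: "inv\<^bsub>R\<^esub> v \<in> base" using inv_homogeneous[OF _ vb] by simp
    have w: "?w \<in> C g" "?w \<in> Units R"
      using base_module_component(1)[OF vi g(1) u(1)] vb u by auto
    have "a \<otimes>\<^bsub>R\<^esub> ?w = ?w \<otimes>\<^bsub>R\<^esub> a" if a: "a \<in> base" for a
    proof -
      have ac: "a \<in> carrier R" using base_closed a .
      have "a \<otimes>\<^bsub>R\<^esub> ?w = inv\<^bsub>R\<^esub> v \<otimes>\<^bsub>R\<^esub> (v \<otimes>\<^bsub>R\<^esub> a \<otimes>\<^bsub>R\<^esub> inv\<^bsub>R\<^esub> v) \<otimes>\<^bsub>R\<^esub> u"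
        using ac c vb by (simp add: R.m_assoc[symmetric])
      also have "... = inv\<^bsub>R\<^esub> v \<otimes>\<^bsub>R\<^esub> (u \<otimes>\<^bsub>R\<^esub> a \<otimes>\<^bsub>R\<^esub> inv\<^bsub>R\<^esub> u) \<otimes>\<^bsub>R\<^esub> u" using eq[OF a] by simp
      also have "... = ?w \<otimes>\<^bsub>R\<^esub> a" using ac c u by (simp add: R.m_assoc)
      finally show ?thesis .
    qed
    then have "bimodule_isomorphic R base (part R C {\<one>\<^bsub>G\<^esub>}) (part R C {g})"
      using commuting_unit_imp_isomorphic[OF g(1) w] part_singleton g by simp
    then have "{\<one>\<^bsub>G\<^esub>} = {g}"
      using con g unfolding controlled_def by (metis G.one_closed empty_subsetI insert_subset)
    then show False using g by simp
  qed
  then show ?thesis unfolding outer_aut_def using conjugation_iso[OF g(1) u] by blast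
qed

text \<open>Since \<open>r\<close> commutes with \<open>R\<^sub>e\<close>, the set \<open>R\<^sub>e r\<close> is a sub-bimodule, and by simplicity it contains a
  unit \<open>u\<close> of degree \<open>g\<close>. From \<open>u = a r = r a\<close> one reads off inverses of \<open>r\<close> on both sides.\<close>

lemma commuting_homogeneous_unit:
  assumes simple: "simple_ring (base_ring G R C)" and g: "g \<in> carrier G"
    and r: "r \<in> C g" "r \<noteq> \<zero>\<^bsub>R\<^esub>" and comm: "\<And>a. a \<in> base \<Longrightarrow> r \<otimes>\<^bsub>R\<^esub> a = a \<otimes>\<^bsub>R\<^esub> r"
  shows "r \<in> Units R"
proof -
  have rc: "r \<in> carrier R" using component_closed g r by blast
  let ?N = "(\<lambda>a. a \<otimes>\<^bsub>R\<^esub> r) ` base"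
  have "sub_bimodule R base ?N"
  proof (rule sub_bimoduleI)
    show "?N \<subseteq> carrier R" using base_closed rc by auto
    show "\<zero>\<^bsub>R\<^esub> \<in> ?N" using component_zero[of "\<one>\<^bsub>G\<^esub>"] rc by (auto intro!: image_eqI[of _ _ "\<zero>\<^bsub>R\<^esub>"])
    show "x \<oplus>\<^bsub>R\<^esub> y \<in> ?N" if xy: "x \<in> ?N" "y \<in> ?N" for x y
    proof -
      obtain a b where ab: "a \<in> base" "b \<in> base" "x = a \<otimes>\<^bsub>R\<^esub> r" "y = b \<otimes>\<^bsub>R\<^esub> r" using xy by blast
      then have "x \<oplus>\<^bsub>R\<^esub> y = (a \<oplus>\<^bsub>R\<^esub> b) \<otimes>\<^bsub>R\<^esub> r" using base_closed rc by (simp add: R.l_distr)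
      then show ?thesis using component_add ab by blast
    qed
    show "a \<otimes>\<^bsub>R\<^esub> x \<in> ?N \<and> x \<otimes>\<^bsub>R\<^esub> a \<in> ?N" if a: "a \<in> base" and x: "x \<in> ?N" for a x
    proof -
      obtain b where b: "b \<in> base" "x = b \<otimes>\<^bsub>R\<^esub> r" using x by blast
      have "a \<otimes>\<^bsub>R\<^esub> x = (a \<otimes>\<^bsub>R\<^esub> b) \<otimes>\<^bsub>R\<^esub> r" "x \<otimes>\<^bsub>R\<^esub> a = (b \<otimes>\<^bsub>R\<^esub> a) \<otimes>\<^bsub>R\<^esub> r"
        using b a base_closed rc comm by (simp_all add: R.m_assoc)
      then show ?thesis using base_mult b a by blast
    qed
  qed
  moreover have "r \<in> ?N" using one_in_base rc by (auto intro!: image_eqI[of _ _ "\<one>\<^bsub>R\<^esub>"])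
  moreover have "component g r \<noteq> \<zero>\<^bsub>R\<^esub>" using component_homogeneous[OF g r(1) g] r by simp
  moreover obtain u where u: "u \<in> C g" "u \<in> Units R" using obtain_unit[OF g] .
  ultimately obtain d where d: "d \<in> ?N" "component g d = u"
    using component_attains_all[OF simple _ _ g, of ?N r u] by blast
  then obtain a where a: "a \<in> base" "d = a \<otimes>\<^bsub>R\<^esub> r" by blast
  then have ar: "a \<otimes>\<^bsub>R\<^esub> r = u"
    using d component_homogeneous[OF g _ g] base_module_component(1)[OF a(1) g r(1)] by simp
  have c: "a \<in> carrier R" "u \<in> carrier R" "inv\<^bsub>R\<^esub> u \<in> carrier R" using a u base_closed by auto
  have "(inv\<^bsub>R\<^esub> u \<otimes>\<^bsub>R\<^esub> a) \<otimes>\<^bsub>R\<^esub> r = \<one>\<^bsub>R\<^esub>" using ar c rc u by (simp add: R.m_assoc)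
  moreover have "r \<otimes>\<^bsub>R\<^esub> (a \<otimes>\<^bsub>R\<^esub> inv\<^bsub>R\<^esub> u) = \<one>\<^bsub>R\<^esub>"
    using ar comm[OF a(1)] c rc u by (simp add: R.m_assoc[symmetric])
  ultimately show ?thesis
    using R.inv_unique[of "inv\<^bsub>R\<^esub> u \<otimes>\<^bsub>R\<^esub> a" r "a \<otimes>\<^bsub>R\<^esub> inv\<^bsub>R\<^esub> u"] c rc unfolding Units_def by auto
qed

text \<open>The components of a centralizing element centralize as well. One that is nonzero of degree
  \<open>g \<noteq> e\<close> would be a unit that acts on \<open>R\<^sub>e\<close> by the identity, which is inner by \<open>v = 1\<close>.\<close>

lemma outer_imp_centralizer:
  assumes simple: "simple_ring (base_ring G R C)"
    and outer: "\<And>g u. g \<in> carrier G \<Longrightarrow> g \<noteq> \<one>\<^bsub>G\<^esub> \<Longrightarrow> u \<in> C g \<Longrightarrow> u \<in> Units R \<Longrightarrow>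
      outer_aut (base_ring G R C) (\<lambda>a. u \<otimes>\<^bsub>R\<^esub> a \<otimes>\<^bsub>R\<^esub> inv\<^bsub>R\<^esub> u)"
  shows "centralizer R base \<subseteq> base"
proof
  fix r assume "r \<in> centralizer R base"
  then have r: "r \<in> carrier R" and comm: "\<And>a. a \<in> base \<Longrightarrow> r \<otimes>\<^bsub>R\<^esub> a = a \<otimes>\<^bsub>R\<^esub> r"
    unfolding centralizer_def by auto
  have "component g r = \<zero>\<^bsub>R\<^esub>" if g: "g \<in> carrier G" "g \<noteq> \<one>\<^bsub>G\<^esub>" for g
  proof (rule ccontr)
    let ?r = "component g r"
    assume nz: "?r \<noteq> \<zero>\<^bsub>R\<^esub>"
    have rg: "?r \<in> C g" using component_in r g by blast
    have commg: "?r \<otimes>\<^bsub>R\<^esub> a = a \<otimes>\<^bsub>R\<^esub> ?r" if "a \<in> base" for a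
      using component_of_base_left[OF that r g(1)] component_of_base_right[OF that r g(1)]
        comm[OF that] by simp
    have rU: "?r \<in> Units R"
      using commuting_homogeneous_unit[OF simple g(1) rg nz commg] by blast
    have "?r \<otimes>\<^bsub>R\<^esub> a \<otimes>\<^bsub>R\<^esub> inv\<^bsub>R\<^esub> ?r = a" if "a \<in> base" for a
      using commg[OF that] base_closed[OF that] rU component_carrier[OF r g(1)]
      by (simp add: R.m_assoc)
    moreover have "\<one>\<^bsub>R\<^esub> \<in> Units (base_ring G R C)" using Units_base one_in_base by simp
    ultimately have "inner_aut (base_ring G R C) (\<lambda>a. ?r \<otimes>\<^bsub>R\<^esub> a \<otimes>\<^bsub>R\<^esub> inv\<^bsub>R\<^esub> ?r)"
      unfolding inner_aut_def using conjugation_iso[OF g(1) rg rU] inv_base base_closed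
      by (auto intro!: bexI[of _ "\<one>\<^bsub>R\<^esub>"])
    then show False using outer[OF g rg rU] unfolding outer_aut_def by blast
  qed
  then have "r \<in> part R C {\<one>\<^bsub>G\<^esub>}" using r by (simp add: part_eq)
  then show "r \<in> base" using part_singleton by simp
qed

end

theorem corollary4p7:
  fixes G :: "('g, 'n) monoid_scheme" and R :: "('a, 'm) ring_scheme" and C :: "'g \<Rightarrow> 'a set"
  assumes "crossed_product G R C"
  shows "(controlled G R C \<longleftrightarrow>
            simple_ring (base_ring G R C) \<and>
            centralizer R (C \<one>\<^bsub>G\<^esub>) = centre (base_ring G R C)) \<and>
         (controlled G R C \<longleftrightarrow>
            simple_ring (base_ring G R C) \<and>
            (\<forall>g\<in>carrier G. g \<noteq> \<one>\<^bsub>G\<^esub> \<longrightarrow> (\<forall>u. u \<in> C g \<and> u \<in> Units R \<longrightarrow>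
               outer_aut (base_ring G R C) (\<lambda>a. u \<otimes>\<^bsub>R\<^esub> a \<otimes>\<^bsub>R\<^esub> inv\<^bsub>R\<^esub> u))))"
proof -
  interpret crossed_product G R C by fact
  have cen: "centralizer R base = centre (base_ring G R C) \<longleftrightarrow> centralizer R base \<subseteq> base"
    unfolding centre_base by blast
  show ?thesis
    unfolding cen
  proof (intro conjI iffI)
    show "controlled G R C" if "simple_ring (base_ring G R C) \<and> centralizer R base \<subseteq> base"
      using controlled_if_simple_centralizer that by blast
    show "controlled G R C"
      if "simple_ring (base_ring G R C) \<and> (\<forall>g\<in>carrier G. g \<noteq> \<one>\<^bsub>G\<^esub> \<longrightarrow> (\<forall>u. u \<in> C g \<and> u \<in> Units R \<longrightarrow>
        outer_aut (base_ring G R C) (\<lambda>a. u \<otimes>\<^bsub>R\<^esub> a \<otimes>\<^bsub>R\<^esub> inv\<^bsub>R\<^esub> u)))"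
      using that by (intro controlled_if_simple_centralizer outer_imp_centralizer) simp_all
    assume con: "controlled G R C"
    show simple: "simple_ring (base_ring G R C)"
      using controlled_imp_simple[OF con] .
    then show "simple_ring (base_ring G R C)" .
    show outer: "\<forall>g\<in>carrier G. g \<noteq> \<one>\<^bsub>G\<^esub> \<longrightarrow> (\<forall>u. u \<in> C g \<and> u \<in> Units R \<longrightarrow>
        outer_aut (base_ring G R C) (\<lambda>a. u \<otimes>\<^bsub>R\<^esub> a \<otimes>\<^bsub>R\<^esub> inv\<^bsub>R\<^esub> u))"
      using controlled_imp_outer[OF con] by simp
    show "centralizer R base \<subseteq> base"
      by (rule outer_imp_centralizer[OF simple]) (use outer in simp)
  qed
qed

end
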